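(* Under the standing assumptions below, there is a constant $C<\infty$ such that for all integers $1\le m<n$, $$b_mb_n\Big|P(S_m=\kappa_m,\,S_n=\kappa_n)-P(S_m=\kappa_m)P(S_n=\kappa_n)\Big|\le C\Big\{\Big(\frac{n}{n-m}\Big)^{1/\alpha}\frac{L(n)}{L(n-m)}+1\Big\}.$$
   Context: Standing assumptions: $(X_n)_{n\ge1}$ are i.i.d. real random variables whose common distribution $F$ is supported on a lattice $\{a+k:\ k\in\mathbb Z\}$ ($a\in\mathbb R$) with maximal span $1$; $S_n=X_1+\dots+X_n$. There exist $\alpha\in(0,2]$ with $\alpha\neq1$, constants $c_1,c_2\ge0$ with $c_1+c_2>0$, and a function $l$ slowly varying at infinity such that, as $x\to\infty$, $x^\alpha P(X_1>x)=(c_1+o(1))l(x)$ and $x^\alpha P(X_1\le -x)=(c_2+o(1))l(x)$. If $\alpha>1$, $E[X_1]=0$. Then $F$ is in the domain of attraction of an $\alpha$-stable law $G$: with $b_n=L(n)n^{1/\alpha}$, where $L$ is slowly varying, $S_n/b_n$ converges in distribution to $G$ (no centering constants needed). The characteristic function $\phi$ of $X_1$ satisfies, as $t\to0$, $\phi(t)=\exp\{-c|t|^\alpha h(1/|t|)(1-i\beta\,\mathrm{sign}(t)\tan\frac{\pi\alpha}{2})+o(|t|^\alpha h(1/|t|))\}$, where for $\alpha<2$: $h=l$, $c=\Gamma(1-\alpha)(c_1+c_2)\cos\frac{\pi\alpha}{2}>0$, $\beta=\frac{c_1-c_2}{c_1+c_2}$; and for $\alpha=2$: $c=1/2$, $\beta=0$,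 $h(x)=E[X_1^2\mathbf 1_{\{|X_1|\le x\}}]$. The function $h$ is slowly varying, determined up to asymptotic equivalence, and is chosen continuous on $[a_0,\infty)$ for some $a_0>0$; moreover $L(n)=h^{1/\alpha}(b_n)$ if $\alpha<2$ and $L(n)=\sqrt{h(b_n)}$ if $\alpha=2$. For each $n$, $\kappa_n$ is a point of the lattice $\{na+k:\ k\in\mathbb Z\}$ (where $S_n$ takes values), and $\kappa_n/b_n\to\kappa\in\mathbb R$ as $n\to\infty$. *)

theory Defs
  imports "HOL-Probability.Probability" "HOL-Library.Landau_Symbols"
begin

definition slowly_varying :: "(real \<Rightarrow> real) \<Rightarrow> bool" where
  "slowly_varying l \<longleftrightarrow> (\<forall>\<^sub>F x in at_top. l x > 0) \<and>
     (\<forall>t>0. ((\<lambda>x. l (t * x) / l x) \<longlongrightarrow> 1) at_top)"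

definition supported_on_lattice :: "'a measure \<Rightarrow> ('a \<Rightarrow> real) \<Rightarrow> real \<Rightarrow> real \<Rightarrow> bool" where
  "supported_on_lattice M Y a d \<longleftrightarrow> (AE \<omega> in M. \<exists>k::int. Y \<omega> = a + d * of_int k)"

definition lattice_maximal_span_one :: "'a measure \<Rightarrow> ('a \<Rightarrow> real) \<Rightarrow> real \<Rightarrow> bool" where
  "lattice_maximal_span_one M Y a \<longleftrightarrow> supported_on_lattice M Y a 1 \<and>
     \<not> (\<exists>a' d. d > 1 \<and> supported_on_lattice M Y a' d)"

definition partial_sum :: "(nat \<Rightarrow> 'a \<Rightarrow> real) \<Rightarrow> nat \<Rightarrow> 'a \<Rightarrow> real" where
  "partial_sum X n \<omega> = (\<Sum>i\<in>{1..n}. X i \<omega>)"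

end

theory Submission
  imports Defs
begin

text \<open>
  By independence \<open>P(S\<^sub>m = \<kappa>\<^sub>m, S\<^sub>n = \<kappa>\<^sub>n) = P(S\<^sub>m = \<kappa>\<^sub>m) P(S\<^sub>n - S\<^sub>m = \<kappa>\<^sub>n - \<kappa>\<^sub>m)\<close>, so it suffices to
  bound \<open>b\<^sub>n P(S\<^sub>n = x)\<close> uniformly over \<open>n\<close> and the lattice points \<open>x\<close>. Fourier inversion gives
  \<open>2\<pi> P(S\<^sub>n = x) \<le> \<integral> |\<phi>(t)|^n dt\<close> over \<open>[-\<pi>, \<pi>]\<close>. With \<open>\<theta> = Arg \<phi>(t)\<close> we have
  \<open>1 - |\<phi>(t)| = E[1 - cos(tX - \<theta>)]\<close>; restricting to \<open>1/|t| < |X| \<le> 2/|t|\<close> (if \<open>\<alpha> < 2\<close>) or to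
  \<open>|X| \<le> 1/|t|\<close> (if \<open>\<alpha> = 2\<close>) yields \<open>1 - |\<phi>(t)| \<ge> c |t|^\<alpha> g(1/|t|)\<close> near \<open>0\<close>, where \<open>g\<close> is
  \<open>y^\<alpha>\<close> times the two-sided tail, respectively the truncated second moment. Both are comparable
  with \<open>h\<close> and, being built from monotone functions, satisfy a Potter bound that follows from
  their behaviour under doubling alone. As \<open>b\<^sub>n^\<alpha> = n h(b\<^sub>n)\<close>, this gives
  \<open>|\<phi>(t)|^n \<le> C / (1 + b\<^sub>n\<^sup>2 t\<^sup>2)\<close>, whose integral is of order \<open>1 / b\<^sub>n\<close>; away from \<open>0\<close> the maximality
  of the span keeps \<open>|\<phi>|\<close> below \<open>1\<close>. The hypotheses do not force \<open>b\<^sub>n\<close> to be large, but the bound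
  is trivial for those \<open>n\<close> where \<open>b\<^sub>n\<close> stays below a constant.
\<close>

section \<open>Modulus of a characteristic function as a cosine integral\<close>

text \<open>Taylor expansion to order four: for \<open>\<bar>u\<bar> \<le> 2\<close> the remainder
  is at most \<open>u^4 / 24\<close>, hence at most a sixth of the square, and 1/2 - 1/6 = 1/3. The
  range 2 leaves room for a phase below 1 added to a product \<open>t * x\<close> of size at most
  1.\<close>

lemma one_minus_cos_ge:
  fixes u :: real
  assumes "\<bar>u\<bar> \<le> 2"
  shows "u\<^sup>2 / 3 \<le> 1 - cos u"
proof -
  obtain t where t: "cos u = (\<Sum>m<4. cos_coeff m * u ^ m) + cos (t + 1/2 * real 4 * pi) / fact 4 * u ^ 4"
    using Maclaurin_cos_expansion[of u 4] by auto
  have s: "(\<Sum>m<4. cos_coeff m * u ^ m) = 1 - u\<^sup>2 / 2"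
    proof -
    have "{..<4} = {0, 1, 2, 3 :: nat}" by auto
    then show ?thesis by (simp add: cos_coeff_def)
  qed
  have u4: "u ^ 4 = u\<^sup>2 * u\<^sup>2" by (simp add: power2_eq_square numeral_eq_Suc)
  have u2: "u\<^sup>2 \<le> 4" using abs_le_square_iff[of u 2] assms by simp
  have "u ^ 4 \<le> 4 * u\<^sup>2" unfolding u4 by (rule mult_right_mono[OF u2]) simp
  moreover have "cos (t + 1/2 * real 4 * pi) / fact 4 * u ^ 4 \<le> 1 / 24 * u ^ 4"
    by (rule mult_right_mono) (auto simp: fact_numeral)
  ultimately show ?thesis using t s by simp
qed

text \<open>Multiplying by the inverse phase carries \<open>z\<close> onto the nonnegative real
  axis. A modulus thereby becomes a real part, which is linear and passes through an
  expectation.\<close>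

lemma cmod_eq_Re_rotated: "cmod z = Re (exp (- (\<i> * of_real (Arg z))) * z)"
proof (cases "z = 0")
  case False
  have "exp (- (\<i> * of_real (Arg z))) * z
      = exp (- (\<i> * of_real (Arg z))) * (of_real (cmod z) * exp (\<i> * of_real (Arg z)))"
    using Arg_eq[OF False] by simp
  also have "\<dots> = of_real (cmod z)" by (simp add: exp_minus field_simps)
  finally show ?thesis by simp
qed simp

lemma (in real_distribution) Re_rotated_char:
  "Re (exp (- (\<i> * of_real s)) * char M t) = (\<integral>x. cos (t * x - s) \<partial>M)"
proof -
  have i: "complex_integrable M (\<lambda>x. iexp (t * x))"
    by (rule integrable_iexp) auto
  have "exp (- (\<i> * of_real s)) * char M t = (CLINT x|M. exp (- (\<i> * of_real s)) * iexp (t * x))"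
    unfolding char_def using i by simp
  also have "\<dots> = (CLINT x|M. cis (t * x - s))"
    by (rule Bochner_Integration.integral_cong)
       (simp_all add: cis_conv_exp exp_add[symmetric] algebra_simps)
  also have "Re \<dots> = (\<integral>x. Re (cis (t * x - s)) \<partial>M)"
    by (rule integral_Re[symmetric]) (auto intro!: integrable_const_bound[where B=1] simp: cis_conv_exp)
  finally show ?thesis by simp
qed

lemma (in real_distribution) one_minus_cmod_char:
  "1 - cmod (char M t) = (\<integral>x. 1 - cos (t * x - Arg (char M t)) \<partial>M)"
proof -
  have "integrable M (\<lambda>x. cos (t * x - Arg (char M t)))"
    by (rule integrable_const_bound[where B=1]) auto
  then show ?thesis
    using cmod_eq_Re_rotated[of "char M t"] unfolding Re_rotated_char by (simp add: prob_space del: space_eq_univ)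
qed

lemma (in real_distribution) one_minus_cmod_char_ge:
  assumes f: "integrable M f" and le: "\<And>x. f x \<le> 1 - cos (t * x - Arg (char M t))"
  shows "(\<integral>x. f x \<partial>M) \<le> 1 - cmod (char M t)"
  unfolding one_minus_cmod_char
proof (rule integral_mono[OF f _ le])
  show "integrable M (\<lambda>x. 1 - cos (t * x - Arg (char M t)))"
    by (intro Bochner_Integration.integrable_diff integrable_const integrable_const_bound[where B=1]) auto
qed

text \<open>The characteristic function is continuous with value 1 at 0, and \<open>Arg\<close> is
  continuous at 1. So the unknown phase in the cosine integral is only a small perturbation near
  0.\<close>

lemma (in real_distribution) eventually_Arg_char_small:
  assumes "0 < e"
  obtains d where "0 < d" "\<And>t. \<bar>t\<bar> < d \<Longrightarrow> \<bar>Arg (char M t)\<bar> < e"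
proof -
  have "isCont (\<lambda>t. Arg (char M t)) 0"
    by (rule isCont_o2[OF isCont_char]) (simp add: char_zero continuous_at_Arg)
  then have "\<exists>d>0. \<forall>t. \<bar>t\<bar> < d \<longrightarrow> \<bar>Arg (char M t)\<bar> < e"
    using assms unfolding continuous_at_eps_delta by (simp add: char_zero dist_real_def)
  then show ?thesis using that by blast
qed

text \<open>If the modulus is 1, the nonnegative function \<open>1 - cos (t * x - s)\<close> has
  integral 0, so \<open>t * x - s\<close> is almost surely a multiple of
  \<open>2 * pi\<close>.\<close>

lemma (in real_distribution) cmod_char_eq_1_imp_lattice:
  assumes "cmod (char M t) = 1" "t \<noteq> 0"
  shows "\<exists>a'. AE x in M. \<exists>k::int. x = a' + 2 * pi / \<bar>t\<bar> * of_int k"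
proof -
  let ?s = "Arg (char M t)"
  have "integrable M (\<lambda>x. 1 - cos (t * x - ?s))"
    by (intro Bochner_Integration.integrable_diff integrable_const integrable_const_bound[where B=1]) auto
  moreover have "(\<integral>x. 1 - cos (t * x - ?s) \<partial>M) = 0"
    using one_minus_cmod_char[of t] assms by simp
  ultimately have "AE x in M. 1 - cos (t * x - ?s) = 0"
    by (subst (asm) integral_nonneg_eq_0_iff_AE) auto
  then have "AE x in M. \<exists>k::int. x = ?s / t + 2 * pi / \<bar>t\<bar> * of_int k"
  proof eventually_elim
    case (elim x)
    then obtain k :: int where k: "t * x - ?s = of_int k * 2 * pi"
      using cos_one_2pi_int by auto
    then have "x = ?s / t + 2 * pi / t * of_int k"
      using assms(2) by (simp add: field_simps)
    \<comment> \<open>The sign of \<open>t\<close> moves into the integer, so that the span is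
      positive, as the maximality hypothesis requires.\<close>
    also have "2 * pi / t * of_int k = 2 * pi / \<bar>t\<bar> * of_int (if t > 0 then k else - k)"
      by auto
    finally show ?case by blast
  qed
  then show ?thesis by blast
qed

section \<open>Fourier inversion at lattice points and the Cauchy kernel\<close>

lemma integral_cos_int_multiple:
  "(\<integral>t. cos (t * of_int k) \<partial>restrict_space lborel {-pi..pi}) = (if k = 0 then 2 * pi else 0)"
proof -
  have "(\<integral>t. cos (t * of_int k) \<partial>restrict_space lborel {-pi..pi})
      = (\<integral>t. cos (t * of_int k) * indicator {-pi..pi} t \<partial>lborel)"
    by (subst integral_restrict_space) (auto simp: mult.commute)
  also have "\<dots> = (if k = 0 then 2 * pi else 0)"
  proof (cases "k = 0")
    case False
    have "(\<integral>t. cos (t * of_int k) * indicator {-pi..pi} t \<partial>lborel)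
        = sin (pi * of_int k) / of_int k - sin (- pi * of_int k) / of_int k"
      by (rule integral_FTC_Icc_real)
         (use False in \<open>auto intro!: derivative_eq_intros continuous_intros\<close>)
    then show ?thesis using False by (simp add: sin_zero_iff_int2 mult.commute)
  qed simp
  finally show ?thesis .
qed

text \<open>Since \<open>Y - x\<close> is almost surely an integer, orthogonality of the cosines
  writes \<open>2 * pi\<close> times the indicator of \<open>Y = x\<close> as an integral over
  \<open>t\<close>. Fubini swaps the integrals, and bounding a real part by the modulus removes all
  dependence on \<open>x\<close>; this is what makes the later bound uniform over lattice
  points.\<close>

lemma (in prob_space) prob_lattice_point_le_char:
  assumes Y [measurable]: "random_variable borel Y"
    and lat: "AE \<omega> in M. \<exists>k::int. Y \<omega> = x + of_int k"
  shows "2 * pi * prob {\<omega>\<in>space M. Y \<omega> = x}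
       \<le> (\<integral>t. cmod (char (distr M borel Y) t) \<partial>restrict_space lborel {-pi..pi})"
proof -
  let ?N = "restrict_space lborel {-pi..pi} :: real measure"
  interpret N: finite_measure ?N
    by standard (simp add: emeasure_restrict_space)
  interpret P: pair_sigma_finite M ?N
    by standard
  interpret P': finite_measure "M \<Otimes>\<^sub>M ?N"
    by (rule finite_measure_pair_measure) unfold_locales
  interpret D: real_distribution "distr M borel Y"
    by (rule real_distribution_distr) fact
  have int: "integrable (M \<Otimes>\<^sub>M ?N) (\<lambda>(\<omega>, t). cos (t * (Y \<omega> - x)))"
  proof (rule P'.integrable_const_bound[where B=1])
    have [measurable]: "(\<lambda>t. t) \<in> borel_measurable ?N"
      by (rule measurable_restrict_space1) simp
    show "(\<lambda>(\<omega>, t). cos (t * (Y \<omega> - x))) \<in> borel_measurable (M \<Otimes>\<^sub>M ?N)"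
      by measurable
  qed auto
  have "2 * pi * prob {\<omega>\<in>space M. Y \<omega> = x} = (\<integral>\<omega>. 2 * pi * indicator {\<omega>\<in>space M. Y \<omega> = x} \<omega> \<partial>M)"
    by simp
  also have "\<dots> = (\<integral>\<omega>. (\<integral>t. cos (t * (Y \<omega> - x)) \<partial>?N) \<partial>M)"
  proof (rule integral_cong_AE)
    show "AE \<omega> in M. 2 * pi * indicator {\<omega>\<in>space M. Y \<omega> = x} \<omega> = (\<integral>t. cos (t * (Y \<omega> - x)) \<partial>?N)"
      using lat AE_space
      by eventually_elim (auto simp: integral_cos_int_multiple)
    show "(\<lambda>\<omega>. \<integral>t. cos (t * (Y \<omega> - x)) \<partial>?N) \<in> borel_measurable M"
      using P.integrable_fst'[OF int] by auto
  qed simp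
  also have "\<dots> = (\<integral>t. (\<integral>\<omega>. cos (t * (Y \<omega> - x)) \<partial>M) \<partial>?N)"
    by (rule P.Fubini_integral[symmetric]) (use int in simp)
  also have "\<dots> \<le> (\<integral>t. cmod (char (distr M borel Y) t) \<partial>?N)"
  proof (rule integral_mono)
    show "integrable ?N (\<lambda>t. \<integral>\<omega>. cos (t * (Y \<omega> - x)) \<partial>M)"
      using P.integrable_snd[OF int] by simp
    show "integrable ?N (\<lambda>t. cmod (char (distr M borel Y) t))"
      by (rule N.integrable_const_bound[where B=1])
         (auto intro!: D.cmod_char_le_1 measurable_restrict_space1)
    fix t
    have "(\<integral>\<omega>. cos (t * (Y \<omega> - x)) \<partial>M) = (\<integral>y. cos (t * y - t * x) \<partial>distr M borel Y)"
      by (subst integral_distr) (auto simp: algebra_simps)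
    also have "\<dots> = Re (exp (- (\<i> * of_real (t * x))) * char (distr M borel Y) t)"
      by (rule D.Re_rotated_char[symmetric])
    also have "\<dots> \<le> cmod (exp (- (\<i> * of_real (t * x))) * char (distr M borel Y) t)"
      by (rule complex_Re_le_cmod)
    also have "\<dots> = cmod (char (distr M borel Y) t)"
      by (simp add: norm_mult norm_exp_eq_Re)
    finally show "(\<integral>\<omega>. cos (t * (Y \<omega> - x)) \<partial>M) \<le> cmod (char (distr M borel Y) t)" .
  qed
  finally show ?thesis .
qed

text \<open>The kernel has primitive \<open>C * arctan (B * t) / B\<close>, and arctan stays below
  \<open>pi / 2\<close>, so the bound scales like \<open>1 / B\<close>.\<close>

lemma integral_le_arctan_kernel:
  assumes f: "f \<in> borel_measurable borel" and B: "B > 0" and C: "C \<ge> 0"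
    and nn: "\<And>t. 0 \<le> f t"
    and le: "\<And>t. \<bar>t\<bar> \<le> pi \<Longrightarrow> f t \<le> C / (1 + B\<^sup>2 * t\<^sup>2)"
  shows "(\<integral>t. f t \<partial>restrict_space lborel {-pi..pi}) \<le> C * pi / B"
proof -
  have nz: "1 + B\<^sup>2 * t\<^sup>2 \<noteq> 0" for t :: real
    by (smt (verit) zero_le_power2 mult_nonneg_nonneg)
  have cont: "continuous_on {-pi..pi} (\<lambda>t. C / (1 + B\<^sup>2 * t\<^sup>2))"
    using nz by (auto intro!: continuous_intros)
  have int: "integrable lborel (\<lambda>t. C / (1 + B\<^sup>2 * t\<^sup>2) * indicator {-pi..pi} t)"
    using borel_integrable_compact[OF _ cont] by (simp add: mult.commute)
  have "(\<integral>t. f t \<partial>restrict_space lborel {-pi..pi}) = (\<integral>t. f t * indicator {-pi..pi} t \<partial>lborel)"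
    by (subst integral_restrict_space) (auto simp: mult.commute)
  also have "\<dots> \<le> (\<integral>t. C / (1 + B\<^sup>2 * t\<^sup>2) * indicator {-pi..pi} t \<partial>lborel)"
  proof (rule integral_mono)
    show "integrable lborel (\<lambda>t. f t * indicator {-pi..pi} t)"
    proof (rule Bochner_Integration.integrable_bound[OF int])
      show "AE t in lborel. norm (f t * indicator {-pi..pi} t)
        \<le> norm (C / (1 + B\<^sup>2 * t\<^sup>2) * indicator {-pi..pi} t)"
      proof (intro AE_I2)
        fix t
        show "norm (f t * indicator {-pi..pi} t) \<le> norm (C / (1 + B\<^sup>2 * t\<^sup>2) * indicator {-pi..pi} t)"
          using le[of t] nn[of t] C by (cases "\<bar>t\<bar> \<le> pi") (auto simp: indicator_def abs_le_iff)
      qed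
    qed (use f in measurable)
    show "f t * indicator {-pi..pi} t \<le> C / (1 + B\<^sup>2 * t\<^sup>2) * indicator {-pi..pi} t" for t
      using le[of t] by (auto simp: indicator_def)
  qed (rule int)
  also have "\<dots> = C * arctan (B * pi) / B - C * arctan (B * (- pi)) / B"
  proof (rule integral_FTC_Icc_real)
    show "((\<lambda>t. C * arctan (B * t) / B) has_real_derivative C / (1 + B\<^sup>2 * t\<^sup>2)) (at t)" for t
      using B nz[of t] by (auto intro!: derivative_eq_intros simp: power_mult_distrib divide_inverse)
    show "isCont (\<lambda>t. C / (1 + B\<^sup>2 * t\<^sup>2)) t" for t
      using nz by (auto intro!: continuous_intros)
  qed simp
  also have "\<dots> = 2 * C * arctan (B * pi) / B" by (simp add: arctan_minus)
  also have "\<dots> \<le> C * pi / B"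
    using B mult_left_mono[of "2 * arctan (B * pi)" pi C] C arctan_ubound[of "B * pi"]
    by (intro divide_right_mono) (simp_all add: mult.left_commute)
  finally show ?thesis .
qed

section \<open>Potter bounds and powers of the characteristic function\<close>

text \<open>Move from \<open>y\<close> up to \<open>x\<close> by doublings: each costs a factor
  \<open>2 powr e\<close>, which is exactly what the halved ratio \<open>x / y\<close> gives back.
  The last, incomplete doubling is paid once, by \<open>D\<close>.\<close>

lemma doubling_imp_potter_bound:
  fixes g :: "real \<Rightarrow> real"
  assumes K: "K > 0" and D: "D \<ge> 0" and e: "e \<ge> 0"
    and pos: "\<And>y. y \<ge> K \<Longrightarrow> g y > 0"
    and dbl: "\<And>y. y \<ge> K \<Longrightarrow> g (2 * y) \<le> 2 powr e * g y"
    and loc: "\<And>y s. y \<ge> K \<Longrightarrow> 1 \<le> s \<Longrightarrow> s \<le> 2 \<Longrightarrow> g (s * y) \<le> D * g y"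
    and xy: "K \<le> y" "y \<le> x"
  shows "g x \<le> D * (x / y) powr e * g y"
proof -
  obtain k where "x / y < 2 ^ k"
    using real_arch_pow[of 2 "x / y"] by auto
  then show ?thesis using xy
  proof (induction k arbitrary: y)
    \<comment> \<open>The base case is void: \<open>y \<le> x\<close> excludes a ratio below
      1.\<close>
    case 0
    then show ?case using K by (simp add: field_simps)
  next
    case (Suc k)
    have y: "y > 0" using K Suc.prems by simp
    show ?case
    proof (cases "x \<le> 2 * y")
      case True
      have "g x \<le> D * g y"
        using loc[of y "x / y"] True Suc.prems y by (simp add: field_simps)
      also have "\<dots> = D * 1 * g y" by simp
      also have "\<dots> \<le> D * (x / y) powr e * g y"
        using pos[of y] D Suc.prems y e
        by (intro mult_right_mono mult_left_mono ge_one_powr_ge_zero) auto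
      finally show ?thesis .
    next
      case False
      have "g x \<le> D * (x / (2 * y)) powr e * g (2 * y)"
        using Suc.prems False y by (intro Suc.IH) (auto simp: field_simps)
      also have "\<dots> \<le> D * (x / (2 * y)) powr e * (2 powr e * g y)"
        using D Suc.prems by (intro mult_left_mono dbl) auto
      also have "\<dots> = D * ((x / (2 * y)) * 2) powr e * g y"
        using y Suc.prems by (subst powr_mult) auto
      finally show ?thesis by simp
    qed
  qed
qed

text \<open>The constant is the maximum of \<open>u powr p * exp (- u)\<close>, attained at
  \<open>u = p\<close>; the logarithmic form of this is the tangent bound for \<open>ln\<close> at
  1.\<close>

lemma exp_minus_le_powr:
  fixes p u :: real
  assumes "p > 0" "u > 0"
  shows "exp (- u) \<le> exp (p * ln p - p) * u powr (- p)"
proof -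
  have "ln (u / p) \<le> u / p - 1" using assms by (intro ln_le_minus_one) simp
  then have "p * ln (u / p) \<le> u - p" using assms by (simp add: field_simps)
  then have "- u \<le> p * ln p - p + (- p) * ln u"
    using assms by (simp add: ln_div algebra_simps)
  then show ?thesis using assms by (simp add: powr_def flip: exp_add)
qed

lemma power_le_exp:
  fixes z u :: real
  assumes "0 \<le> z" "z \<le> 1 - u"
  shows "z ^ n \<le> exp (- (real n * u))"
proof -
  have "z \<le> exp (- u)" using assms exp_ge_add_one_self[of "- u"] by linarith
  then have "z ^ n \<le> exp (- u) ^ n" using assms by (intro power_mono)
  then show ?thesis by (simp add: exp_of_nat_mult[symmetric])
qed

text \<open>The annulus is compact, so a continuous function attains its supremum there, and that
  value is below 1. For \<open>d > R\<close> the annulus is empty and any gap serves.\<close>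

lemma annulus_bound_less_one:
  fixes f :: "real \<Rightarrow> real"
  assumes cont: "continuous_on UNIV f" and d: "0 < d"
    and lt: "\<And>t. t \<noteq> 0 \<Longrightarrow> \<bar>t\<bar> \<le> R \<Longrightarrow> f t < 1"
  obtains r where "0 < r" "\<And>t. d \<le> \<bar>t\<bar> \<Longrightarrow> \<bar>t\<bar> \<le> R \<Longrightarrow> f t \<le> 1 - r"
proof -
  define S where "S = {- R..- d} \<union> {d..R}"
  have S: "t \<in> S" if "d \<le> \<bar>t\<bar>" "\<bar>t\<bar> \<le> R" for t using that by (auto simp: S_def)
  have comp: "compact S" by (auto simp: S_def intro: compact_Un)
  show ?thesis
  proof (cases "S = {}")
    case True
    then show ?thesis using S by (intro that[of 1]) auto
  next
    case False
    then obtain s where s: "s \<in> S" "\<And>t. t \<in> S \<Longrightarrow> f t \<le> f s"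
      using continuous_attains_sup[OF comp False continuous_on_subset[OF cont]] by auto
    have "f s < 1" using s(1) d by (intro lt) (auto simp: S_def)
    then show ?thesis using S s by (intro that[of "1 - f s"]) auto
  qed
qed

text \<open>The exponent \<open>\<alpha> / 2\<close> in the Potter bound is an arbitrary choice below \<open>\<alpha>\<close>; it leaves
  decay of order \<open>exp (- c * (B * \<bar>t\<bar>) powr (\<alpha> / 2))\<close>, more than the inverse square asked for.\<close>

lemma power_le_cauchy_kernel:
  fixes f g :: "real \<Rightarrow> real"
  assumes cont: "continuous_on UNIV f" and f01: "\<And>t. 0 \<le> f t" "\<And>t. f t \<le> 1"
    and lt: "\<And>t. t \<noteq> 0 \<Longrightarrow> \<bar>t\<bar> \<le> R \<Longrightarrow> f t < 1"
    and \<alpha>: "\<alpha> > 0" and K: "K > 0" and c: "c > 0" and D: "D > 0" and A: "A > 0"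
    and pos: "\<And>y. y \<ge> K \<Longrightarrow> g y > 0"
    and potter: "\<And>x y. K \<le> y \<Longrightarrow> y \<le> x \<Longrightarrow> g x \<le> D * (x / y) powr (\<alpha> / 2) * g y"
    and decay: "\<And>t. t \<noteq> 0 \<Longrightarrow> \<bar>t\<bar> \<le> 1 / K \<Longrightarrow> c * \<bar>t\<bar> powr \<alpha> * g (1 / \<bar>t\<bar>) \<le> 1 - f t"
  shows "\<exists>C\<ge>0. \<forall>B\<ge>K. \<forall>n\<ge>1. \<forall>t. B powr \<alpha> \<le> A * real n * g B \<longrightarrow> \<bar>t\<bar> \<le> R
      \<longrightarrow> f t ^ n \<le> C / (1 + B\<^sup>2 * t\<^sup>2)"
proof -
  obtain r where r: "r > 0" "\<And>t. 1 / K \<le> \<bar>t\<bar> \<Longrightarrow> \<bar>t\<bar> \<le> R \<Longrightarrow> f t \<le> 1 - r"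
    using annulus_bound_less_one[OF cont _ lt, of "1 / K"] K by auto
  \<comment> \<open>Chosen so that \<open>w powr (\<alpha> / 2)\<close> raised to \<open>- p\<close>
    is exactly the inverse square of \<open>w\<close>.\<close>
  define p where "p = 4 / \<alpha>"
  have p: "p > 0" using \<alpha> by (simp add: p_def)
  define Q where "Q = exp (p * ln p - p)"
  have Q: "exp (- u) \<le> Q * u powr (- p)" if "u > 0" for u
    unfolding Q_def using exp_minus_le_powr[OF p that] .
  have Q0: "Q > 0" by (simp add: Q_def)
  define E where "E = A * D * K powr (- (\<alpha> / 2)) * g K"
  have E: "E > 0" using A D K pos[of K] by (simp add: E_def)
  define C1 where "C1 = Q * (c / (A * D)) powr (- p)"
  define C2 where "C2 = Q * (r / E) powr (- p) * (1 / K\<^sup>2 + R\<^sup>2)"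
  have C12: "C1 \<ge> 0" "C2 \<ge> 0" using Q0 by (auto simp: C1_def C2_def)
  \<comment> \<open>One summand per range of \<open>t\<close>. For
    \<open>\<bar>t\<bar> \<le> 1 / B\<close> the denominator is at most 2; in the middle range
    \<open>w \<ge> 1\<close> makes it at most twice the square of \<open>w\<close>; beyond
    \<open>1 / K\<close> it is at most the square of \<open>B\<close> times the bracket in
    \<open>C2\<close>.\<close>
  define C where "C = 2 + 2 * C1 + C2"
  have frac_le_cross: "x / z \<le> y / w" if "0 < z" "0 < w" "x * w \<le> y * z" for x y z w :: real
    using that by (simp add: field_simps)
  have den: "1 + B\<^sup>2 * t\<^sup>2 > 0" for B t :: real
    by (smt (verit) zero_le_power2 mult_nonneg_nonneg)
  have w2: "(w powr (\<alpha> / 2)) powr (- p) = 1 / w\<^sup>2" if "w > 0" for w :: real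
    using that \<alpha> by (simp add: powr_powr p_def powr_minus_divide)
  have main: "f t ^ n \<le> C / (1 + B\<^sup>2 * t\<^sup>2)"
    if B: "B \<ge> K" and n: "n \<ge> 1" and hB: "B powr \<alpha> \<le> A * real n * g B" and t: "\<bar>t\<bar> \<le> R" for B n t
  proof -
    have B0: "B > 0" using B K by simp
    consider "\<bar>t\<bar> \<le> 1 / B" | "1 / B < \<bar>t\<bar>" "\<bar>t\<bar> \<le> 1 / K" | "1 / K < \<bar>t\<bar>" by linarith
    then show ?thesis
    proof cases
      case 1
      have "(B * \<bar>t\<bar>)\<^sup>2 \<le> 1\<^sup>2" using 1 B0 by (intro power_mono) (auto simp: field_simps)
      then have "1 + B\<^sup>2 * t\<^sup>2 \<le> C" using C12 by (simp add: power_mult_distrib C_def)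
      then have "1 \<le> C / (1 + B\<^sup>2 * t\<^sup>2)" using den[of B t] by simp
      moreover have "f t ^ n \<le> 1" using f01 by (intro power_le_one)
      ultimately show ?thesis by linarith
    next
      case 2
      define w where "w = B * \<bar>t\<bar>"
      have t0: "\<bar>t\<bar> > 0" using 2 B0 by (smt (verit) divide_pos_pos)
      have w: "w \<ge> 1" using 2 B0 by (simp add: w_def field_simps)
      have y: "K \<le> 1 / \<bar>t\<bar>" "1 / \<bar>t\<bar> \<le> B" using 2 B0 t0 K by (auto simp: field_simps)
      have gB: "g B \<le> D * w powr (\<alpha> / 2) * g (1 / \<bar>t\<bar>)"
        using potter[OF y] by (simp add: w_def)
      \<comment> \<open>The growth condition at \<open>B\<close> involves \<open>g B\<close>, the
        decay at \<open>t\<close> involves \<open>g (1 / \<bar>t\<bar>)\<close>. The Potter bound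
        exchanges one for the other at the cost of half the power of \<open>w\<close>; the other
        half survives as a lower bound for the exponent.\<close>
      have "w powr \<alpha> = B powr \<alpha> * \<bar>t\<bar> powr \<alpha>"
        using B0 by (simp add: w_def powr_mult)
      also have "\<dots> \<le> A * real n * g B * \<bar>t\<bar> powr \<alpha>"
        by (rule mult_right_mono[OF hB]) simp
      also have "\<dots> \<le> A * real n * (D * w powr (\<alpha> / 2) * g (1 / \<bar>t\<bar>)) * \<bar>t\<bar> powr \<alpha>"
        using A gB by (intro mult_right_mono mult_left_mono) auto
      finally have "w powr \<alpha> \<le> w powr (\<alpha> / 2) * (A * D * real n * (\<bar>t\<bar> powr \<alpha> * g (1 / \<bar>t\<bar>)))"
        by (simp add: mult_ac)
      moreover have "w powr \<alpha> = w powr (\<alpha> / 2) * w powr (\<alpha> / 2)"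
        by (simp flip: powr_add)
      ultimately have "w powr (\<alpha> / 2) \<le> A * D * real n * (\<bar>t\<bar> powr \<alpha> * g (1 / \<bar>t\<bar>))"
        using w by simp
      then have "c / (A * D) * w powr (\<alpha> / 2)
          \<le> c / (A * D) * (A * D * real n * (\<bar>t\<bar> powr \<alpha> * g (1 / \<bar>t\<bar>)))"
        using A D c by (intro mult_left_mono) auto
      also have "\<dots> = real n * (c * \<bar>t\<bar> powr \<alpha> * g (1 / \<bar>t\<bar>))"
        using A D by simp
      finally have u: "c / (A * D) * w powr (\<alpha> / 2) \<le> real n * (c * \<bar>t\<bar> powr \<alpha> * g (1 / \<bar>t\<bar>))" .
      have "f t ^ n \<le> exp (- (real n * (c * \<bar>t\<bar> powr \<alpha> * g (1 / \<bar>t\<bar>))))"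
        using decay[of t] t0 2 f01[of t] by (intro power_le_exp) auto
      also have "\<dots> \<le> exp (- (c / (A * D) * w powr (\<alpha> / 2)))"
        using u by simp
      also have "\<dots> \<le> Q * (c / (A * D) * w powr (\<alpha> / 2)) powr (- p)"
        using c A D w by (intro Q) auto
      also have "\<dots> = C1 / w\<^sup>2"
        using c A D w by (subst powr_mult) (auto simp: w2 C1_def)
      also have "\<dots> \<le> C / (1 + B\<^sup>2 * t\<^sup>2)"
      proof -
        have ww: "w\<^sup>2 = B\<^sup>2 * t\<^sup>2" by (simp add: w_def power_mult_distrib)
        have w1: "1 \<le> w\<^sup>2" using w by (rule one_le_power)
        have "C1 * (1 + w\<^sup>2) \<le> C1 * (2 * w\<^sup>2)" using w1 C12 by (intro mult_left_mono) auto
        also have "\<dots> = 2 * C1 * w\<^sup>2" by simp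
        also have "\<dots> \<le> C * w\<^sup>2" using C12 by (intro mult_right_mono) (auto simp: C_def)
        finally show ?thesis
          unfolding ww[symmetric] by (rule frac_le_cross[rotated 2]) (use w1 in linarith)+
      qed
      finally show ?thesis .
    next
      case 3
      \<comment> \<open>Here only the fixed gap \<open>r\<close> is available. The Potter bound
        between \<open>K\<close> and \<open>B\<close> shows that \<open>n\<close> is at least of
        order \<open>B powr (\<alpha> / 2)\<close>, so \<open>exp (- (n * r))\<close> still beats
        every power of \<open>B\<close>.\<close>
      have "B powr (\<alpha> / 2) * B powr (\<alpha> / 2) = B powr \<alpha>" by (simp flip: powr_add)
      also note hB
      also have "A * real n * g B \<le> A * real n * (D * (B / K) powr (\<alpha> / 2) * g K)"
        using A potter[of K B] B by (intro mult_left_mono) auto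
      also have "\<dots> = B powr (\<alpha> / 2) * (E * real n)"
        using B0 K by (simp add: E_def powr_divide powr_minus_divide)
      finally have BE: "B powr (\<alpha> / 2) \<le> E * real n"
        using B0 by simp
      have "f t ^ n \<le> exp (- (real n * r))"
        using r(2)[of t] 3 t f01[of t] by (intro power_le_exp) auto
      also have "\<dots> \<le> exp (- (r / E * B powr (\<alpha> / 2)))"
        using BE E r(1) by (simp add: field_simps)
      also have "\<dots> \<le> Q * (r / E * B powr (\<alpha> / 2)) powr (- p)"
        using r E B0 by (intro Q) auto
      also have "\<dots> = Q * (r / E) powr (- p) / B\<^sup>2"
        using r E B0 by (subst powr_mult) (auto simp: w2)
      also have "\<dots> \<le> C / (1 + B\<^sup>2 * t\<^sup>2)"
      proof -
        have "t\<^sup>2 \<le> R\<^sup>2" using t by (intro iffD1[OF abs_le_square_iff]) linarith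
        moreover have "1 \<le> B\<^sup>2 * (1 / K\<^sup>2)"
          using power_mono[OF B, of 2] K by simp
        ultimately have "1 + B\<^sup>2 * t\<^sup>2 \<le> B\<^sup>2 * (1 / K\<^sup>2 + R\<^sup>2)"
          by (simp add: distrib_left mult_left_mono add_mono)
        then have "Q * (r / E) powr (- p) * (1 + B\<^sup>2 * t\<^sup>2)
            \<le> Q * (r / E) powr (- p) * (B\<^sup>2 * (1 / K\<^sup>2 + R\<^sup>2))"
          using Q0 by (intro mult_left_mono) auto
        also have "\<dots> = C2 * B\<^sup>2" by (simp add: C2_def)
        also have "\<dots> \<le> C * B\<^sup>2" using C12 by (intro mult_right_mono) (auto simp: C_def)
        finally show ?thesis
          by (rule frac_le_cross[rotated 2]) (use den[of B t] B0 in \<open>auto intro: zero_less_power\<close>)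
      qed
      finally show ?thesis .
    qed
  qed
  have "C \<ge> 0" using C12 by (simp add: C_def)
  then show ?thesis using main by blast
qed

section \<open>Decay of the characteristic function near zero\<close>

text \<open>Recasts a statement about small \<open>t\<close> as one about all large thresholds
  \<open>K\<close>, so that it can be combined with other eventual conditions into a single choice
  of \<open>K\<close>.\<close>

lemma eventually_near_zero:
  fixes d K0 :: real
  assumes d: "d > 0" and P: "\<And>t. t \<noteq> 0 \<Longrightarrow> \<bar>t\<bar> < d \<Longrightarrow> K0 \<le> 1 / \<bar>t\<bar> \<Longrightarrow> P t"
  shows "\<forall>\<^sub>F K in at_top. \<forall>t. t \<noteq> 0 \<longrightarrow> \<bar>t\<bar> \<le> 1 / K \<longrightarrow> P t"
  using eventually_ge_at_top[of K0] eventually_gt_at_top[of "1 / d"] eventually_gt_at_top[of 0]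
proof eventually_elim
  case (elim K)
  have "1 / K < d" using elim d by (simp add: field_simps)
  show ?case
  proof (intro allI impI)
    fix t :: real assume t: "t \<noteq> 0" "\<bar>t\<bar> \<le> 1 / K"
    then have "K \<le> 1 / \<bar>t\<bar>" using elim by (simp add: field_simps)
    then show "P t"
      using t \<open>1 / K < d\<close> elim by (intro P) auto
  qed
qed

text \<open>Growth of \<open>g\<close> by at most \<open>2 powr (\<alpha> / 2)\<close> under
  doubling means that the tail itself shrinks by the factor \<open>2 powr (- (\<alpha> / 2))\<close>
  at least. Hence the annulus between \<open>y\<close> and \<open>2 * y\<close> carries a fixed
  share of the tail mass beyond \<open>y\<close>. With \<open>y = 1 / \<bar>t\<bar>\<close> the
  angle there is bounded away from the multiples of \<open>2 * pi\<close>.\<close>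

lemma (in real_distribution) char_decay_regular_tail:
  fixes \<alpha> :: real
  defines "g \<equiv> \<lambda>y. y powr \<alpha> * (measure M {y<..} + measure M {..-y})"
  assumes \<alpha>: "\<alpha> > 0"
    and dbl: "\<forall>\<^sub>F y in at_top. g (2 * y) \<le> 2 powr (\<alpha> / 2) * g y"
  shows "\<exists>c>0. \<forall>\<^sub>F K in at_top. \<forall>t. t \<noteq> 0 \<longrightarrow> \<bar>t\<bar> \<le> 1 / K \<longrightarrow>
           c * \<bar>t\<bar> powr \<alpha> * g (1 / \<bar>t\<bar>) \<le> 1 - cmod (char M t)"
proof -
  obtain d where d: "d > 0" "\<And>t. \<bar>t\<bar> < d \<Longrightarrow> \<bar>Arg (char M t)\<bar> < 1 / 2"
    using eventually_Arg_char_small[of "1 / 2"] by auto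
  obtain K0 where K0: "\<And>y. y \<ge> K0 \<Longrightarrow> g (2 * y) \<le> 2 powr (\<alpha> / 2) * g y"
    using dbl unfolding eventually_at_top_linorder by auto
  \<comment> \<open>On the annulus \<open>\<bar>t * x\<bar>\<close> lies in [1, 2] and the phase is
    below 1/2, so the angle has modulus between 1/2 and \<open>pi\<close>, where the cosine
    decreases.\<close>
  define c0 :: real where "c0 = 1 - cos (1 / 2)"
  have "cos (1 / 2) < cos (0::real)"
    by (rule cos_monotone_0_pi) (use pi_gt3 in auto)
  then have c0: "c0 > 0" by (simp add: c0_def)
  define c where "c = c0 * (1 - 2 powr (- (\<alpha> / 2)))"
  have c: "c > 0" using c0 \<alpha> by (simp add: c_def powr_less_one)
  have est: "c * \<bar>t\<bar> powr \<alpha> * g (1 / \<bar>t\<bar>) \<le> 1 - cmod (char M t)"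
    if t: "t \<noteq> 0" "\<bar>t\<bar> < d" "K0 \<le> 1 / \<bar>t\<bar>" for t
  proof -
    define y where "y = 1 / \<bar>t\<bar>"
    have y: "y > 0" "y \<ge> K0" using t by (auto simp: y_def)
    define T where "T = (\<lambda>y. measure M {y<..} + measure M {..-y})"
    \<comment> \<open>The half-open ends match the two tails \<open>{y<..}\<close> and
      \<open>{..-y}\<close>, so that the mass of \<open>S\<close> is an exact difference of tails
      even in the presence of atoms.\<close>
    define S where "S = {y<..2 * y} \<union> {- (2 * y)<..- y}"
    have "measure M S = measure M {y<..2 * y} + measure M {- (2 * y)<..- y}"
      unfolding S_def using y by (intro finite_measure_Union) auto
    also have "{y<..2 * y} = {y<..} - {2 * y<..}" using y by auto
    also have "measure M \<dots> = measure M {y<..} - measure M {2 * y<..}"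
      using y by (intro finite_measure_Diff) auto
    also have "{- (2 * y)<..- y} = {..- y} - {..- (2 * y)}" using y by auto
    also have "measure M \<dots> = measure M {..- y} - measure M {..- (2 * y)}"
      using y by (intro finite_measure_Diff) auto
    finally have mS: "measure M S = T y - T (2 * y)" by (simp add: T_def)
    have Ty: "T z = z powr (- \<alpha>) * g z" if "z > 0" for z
      using that by (simp add: T_def g_def powr_minus)
    have "T (2 * y) \<le> (2 * y) powr (- \<alpha>) * (2 powr (\<alpha> / 2) * g y)"
      using y K0[of y] by (subst Ty) (auto intro!: mult_left_mono)
    also have "\<dots> = (2 powr (- \<alpha>) * 2 powr (\<alpha> / 2)) * (y powr (- \<alpha>) * g y)"
      using y by (simp add: powr_mult)
    also have "2 powr (- \<alpha>) * 2 powr (\<alpha> / 2) = 2 powr (- (\<alpha> / 2))"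
      by (simp flip: powr_add)
    finally have "(1 - 2 powr (- (\<alpha> / 2))) * (y powr (- \<alpha>) * g y) \<le> measure M S"
      unfolding mS using Ty[OF y(1)] by (simp add: algebra_simps)
    then have "c * (y powr (- \<alpha>) * g y) \<le> c0 * measure M S"
      using c0 by (simp add: c_def mult.assoc)
    also have "c0 * measure M S = (\<integral>x. c0 * indicator S x \<partial>M)"
      by (simp add: S_def)
    also have "\<dots> \<le> 1 - cmod (char M t)"
    proof (rule one_minus_cmod_char_ge)
      show "integrable M (\<lambda>x. c0 * indicator S x)" by (simp add: S_def emeasure_eq_measure)
      fix x
      let ?u = "t * x - Arg (char M t)"
      show "c0 * indicator S x \<le> 1 - cos ?u"
      proof (cases "x \<in> S")
        case True
        then have "y < \<bar>x\<bar> \<or> y \<le> \<bar>x\<bar>" "\<bar>x\<bar> \<le> 2 * y" using y by (auto simp: S_def)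
        then have "1 \<le> \<bar>t * x\<bar>" "\<bar>t * x\<bar> \<le> 2"
          using t by (auto simp: y_def abs_mult field_simps)
        then have "1 / 2 \<le> \<bar>?u\<bar>" "\<bar>?u\<bar> \<le> pi"
          using d(2)[OF t(2)] pi_gt3 by linarith+
        then have "cos \<bar>?u\<bar> \<le> cos (1 / 2)"
          by (intro cos_monotone_0_pi_le) auto
        then show ?thesis using True by (simp add: c0_def)
      qed simp
    qed
    finally show ?thesis
      using t by (simp add: y_def powr_divide powr_minus_divide mult_ac)
  qed
  have "\<forall>\<^sub>F K in at_top. \<forall>t. t \<noteq> 0 \<longrightarrow> \<bar>t\<bar> \<le> 1 / K \<longrightarrow>
           c * \<bar>t\<bar> powr \<alpha> * g (1 / \<bar>t\<bar>) \<le> 1 - cmod (char M t)"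
    by (rule eventually_near_zero[OF d(1) est])
  then show ?thesis using c by blast
qed

lemma (in real_distribution) truncated_expectation_tendsto:
  fixes f :: "real \<Rightarrow> real"
  assumes f: "integrable M f"
  shows "((\<lambda>y. \<integral>x. f x * indicator {-y..y} x \<partial>M) \<longlongrightarrow> (\<integral>x. f x \<partial>M)) at_top"
proof (rule integral_dominated_convergence_at_top[where w="\<lambda>x. \<bar>f x\<bar>"])
  show "AE x in M. ((\<lambda>y. f x * indicator {-y..y} x) \<longlongrightarrow> f x) at_top"
  proof (intro AE_I2 tendsto_eventually)
    fix x
    show "\<forall>\<^sub>F y in at_top. f x * indicator {-y..y} x = f x"
      using eventually_ge_at_top[of "\<bar>x\<bar>"] by eventually_elim (auto simp: indicator_def)
  qed
  show "\<forall>\<^sub>F y in at_top. AE x in M. norm (f x * indicator {-y..y} x) \<le> \<bar>f x\<bar>"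
    by (intro always_eventually allI AE_I2) (auto simp: indicator_def)
qed (use f in auto)

lemma (in real_distribution) integrable_truncated_square:
  "integrable M (\<lambda>x. x\<^sup>2 * indicator {-y..y} x)"
  by (rule integrable_const_bound[where B="y\<^sup>2"])
     (auto simp: indicator_def abs_le_square_iff[symmetric])

lemma (in real_distribution) truncated_square_mono:
  assumes "y \<le> z"
  shows "(\<integral>x. x\<^sup>2 * indicator {-y..y} x \<partial>M) \<le> (\<integral>x. x\<^sup>2 * indicator {-z..z} x \<partial>M)"
  using assms by (intro integral_mono integrable_truncated_square) (auto simp: indicator_def)

text \<open>On \<open>\<bar>x\<bar> \<le> 1 / \<bar>t\<bar>\<close> the cosine is replaced by its
  quadratic bound, and expanding the square produces the truncated moments \<open>V\<close>,
  \<open>m\<close> and \<open>p\<close>. The phase \<open>s\<close> is unknown, so the cross term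
  must be absorbed; centering makes \<open>m\<close> small enough for this.\<close>

lemma (in real_distribution) char_decay_truncated_variance:
  defines "V \<equiv> \<lambda>y. \<integral>x. x\<^sup>2 * indicator {-y..y} x \<partial>M"
  assumes int: "integrable M (\<lambda>x. x)" and mean: "(\<integral>x. x \<partial>M) = 0"
    and pos: "\<forall>\<^sub>F y in at_top. V y > 0"
  shows "\<exists>c>0. \<forall>\<^sub>F K in at_top. \<forall>t. t \<noteq> 0 \<longrightarrow> \<bar>t\<bar> \<le> 1 / K \<longrightarrow>
           c * \<bar>t\<bar> powr 2 * V (1 / \<bar>t\<bar>) \<le> 1 - cmod (char M t)"
proof -
  note intV = integrable_truncated_square
  have int1: "integrable M (\<lambda>x. x * indicator {-y..y} x)" for y
    by (rule integrable_const_bound[where B="\<bar>y\<bar>"]) (auto simp: indicator_def)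
  have int0: "integrable M (\<lambda>x. indicator {-y..y} x :: real)" for y
    by (simp add: emeasure_eq_measure)
  define m where "m = (\<lambda>y. \<integral>x. x * indicator {-y..y} x \<partial>M)"
  define p where "p = (\<lambda>y. \<integral>x. indicator {-y..y} x \<partial>M :: real)"
  have m: "(m \<longlongrightarrow> 0) at_top"
    using truncated_expectation_tendsto[OF int] mean by (simp add: m_def)
  have p: "(p \<longlongrightarrow> 1) at_top"
    using truncated_expectation_tendsto[of "\<lambda>_. 1"] prob_space by (simp add: p_def)
  obtain y0 where y0: "V y0 > 0"
    using eventually_happens[OF pos] by auto
  have V_mono: "V y \<le> V z" if "y \<le> z" for y z
    unfolding V_def using that by (rule truncated_square_mono)
  \<comment> \<open>As \<open>V\<close> is monotone, one positive value \<open>V y0\<close> stays a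
    lower bound for \<open>V\<close>, while \<open>m\<close> tends to 0.\<close>
  have "((\<lambda>y. 4 * (m y)\<^sup>2) \<longlongrightarrow> 4 * 0\<^sup>2) at_top" by (intro tendsto_intros m)
  then have "\<forall>\<^sub>F y in at_top. 4 * (m y)\<^sup>2 < V y0"
    using y0 by (intro order_tendstoD(2)) auto
  moreover have "\<forall>\<^sub>F y in at_top. 1 / 2 < p y"
    by (rule order_tendstoD(1)[OF p]) simp
  ultimately have "\<forall>\<^sub>F y in at_top. 4 * (m y)\<^sup>2 \<le> V y \<and> 1 / 2 < p y"
    using eventually_ge_at_top[of y0] by eventually_elim (use V_mono in force)
  then obtain K0 where K0: "\<And>y. y \<ge> K0 \<Longrightarrow> 4 * (m y)\<^sup>2 \<le> V y" "\<And>y. y \<ge> K0 \<Longrightarrow> 1 / 2 < p y"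
    unfolding eventually_at_top_linorder by auto
  obtain d where d: "d > 0" "\<And>t. \<bar>t\<bar> < d \<Longrightarrow> \<bar>Arg (char M t)\<bar> < 1"
    using eventually_Arg_char_small[of 1] by auto
  have est: "1 / 6 * \<bar>t\<bar> powr 2 * V (1 / \<bar>t\<bar>) \<le> 1 - cmod (char M t)"
    if t: "t \<noteq> 0" "\<bar>t\<bar> < d" "K0 \<le> 1 / \<bar>t\<bar>" for t
  proof -
    define y where "y = 1 / \<bar>t\<bar>"
    define s where "s = Arg (char M t)"
    let ?f = "\<lambda>x. 1 / 3 * (t\<^sup>2 * (x\<^sup>2 * indicator {-y..y} x) - 2 * t * s * (x * indicator {-y..y} x)
        + s\<^sup>2 * indicator {-y..y} x)"
    have intf: "integrable M ?f" using intV int1 int0 by simp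
    have "(\<integral>x. ?f x \<partial>M) \<le> 1 - cmod (char M t)"
    proof (rule one_minus_cmod_char_ge[OF intf])
      fix x
      let ?u = "t * x - Arg (char M t)"
      show "?f x \<le> 1 - cos ?u"
      proof (cases "x \<in> {-y..y}")
        case True
        then have "\<bar>x\<bar> \<le> y" by auto
        then have "\<bar>t * x\<bar> \<le> 1" using t by (simp add: y_def abs_mult field_simps)
        then have "\<bar>?u\<bar> \<le> 2" using d(2)[OF t(2)] by linarith
        then have "?u\<^sup>2 / 3 \<le> 1 - cos ?u" by (rule one_minus_cos_ge)
        then show ?thesis using True
          by (simp add: s_def power2_eq_square algebra_simps add_divide_distrib diff_divide_distrib)
      qed simp
    qed
    also have "(\<integral>x. ?f x \<partial>M) = 1 / 3 * (t\<^sup>2 * V y - 2 * t * s * m y + s\<^sup>2 * p y)"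
      using intV int1 int0 by (simp add: V_def m_def p_def)
    finally have le: "1 / 3 * (t\<^sup>2 * V y - 2 * t * s * m y + s\<^sup>2 * p y) \<le> 1 - cmod (char M t)" .
    \<comment> \<open>Completing the square splits the cross term: its \<open>s\<close> part is
      covered by \<open>p > 1/2\<close>, its \<open>t\<close> part by half of \<open>V\<close>. The
      remaining half of \<open>V\<close>, times 1/3, gives the constant 1/6.\<close>
    have "0 \<le> (s - 2 * t * m y)\<^sup>2" by simp
    then have "2 * t * s * m y \<le> s\<^sup>2 * (1 / 2) + t\<^sup>2 * (2 * (m y)\<^sup>2)"
      by (simp add: power2_eq_square algebra_simps)
    also have "\<dots> \<le> s\<^sup>2 * p y + t\<^sup>2 * (V y / 2)"
      using K0[of y] t(3) by (intro add_mono mult_left_mono) (auto simp: y_def)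
    finally have "1 / 6 * (t\<^sup>2 * V y) \<le> 1 - cmod (char M t)"
      using le by (simp add: algebra_simps)
    then show ?thesis using t by (simp add: y_def mult.assoc)
  qed
  have "\<forall>\<^sub>F K in at_top. \<forall>t. t \<noteq> 0 \<longrightarrow> \<bar>t\<bar> \<le> 1 / K \<longrightarrow>
           1 / 6 * \<bar>t\<bar> powr 2 * V (1 / \<bar>t\<bar>) \<le> 1 - cmod (char M t)"
    by (rule eventually_near_zero[OF d(1) est])
  then show ?thesis by (intro exI[of _ "1 / 6"]) auto
qed

section \<open>Comparing \<open>h\<close> with tails or truncated variance\<close>

text \<open>The quotient \<open>g (2 * x) / g x\<close> factors through \<open>h\<close> into
  quotients with known limits; it tends to 1, so any \<open>q > 1\<close> eventually bounds
  it.\<close>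

lemma slowly_varying_equiv_doubling:
  fixes g h :: "real \<Rightarrow> real"
  assumes sv: "slowly_varying h" and lim: "((\<lambda>x. g x / h x) \<longlongrightarrow> C) at_top" and C: "C > 0" and q: "q > 1"
  shows "\<forall>\<^sub>F x in at_top. g x > 0 \<and> h x \<le> 2 / C * g x \<and> g (2 * x) \<le> q * g x"
proof -
  have hpos: "\<forall>\<^sub>F x in at_top. h x > 0" and h2: "((\<lambda>x. h (2 * x) / h x) \<longlongrightarrow> 1) at_top"
    using sv by (auto simp: slowly_varying_def)
  have two: "filterlim (\<lambda>x::real. 2 * x) at_top at_top"
    by (rule filterlim_tendsto_pos_mult_at_top[OF tendsto_const]) (auto simp: filterlim_ident)
  have "((\<lambda>x. g (2 * x) / h (2 * x) * (h (2 * x) / h x) / (g x / h x)) \<longlongrightarrow> C * 1 / C) at_top"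
    using C by (intro tendsto_intros lim h2 filterlim_compose[OF lim two]) auto
  then have "\<forall>\<^sub>F x in at_top. g (2 * x) / h (2 * x) * (h (2 * x) / h x) / (g x / h x) < q"
    using C q by (intro order_tendstoD(2)) auto
  moreover have "\<forall>\<^sub>F x in at_top. C / 2 < g x / h x"
    using C by (intro order_tendstoD(1)[OF lim]) auto
  moreover have "\<forall>\<^sub>F x in at_top. h (2 * x) > 0"
    using hpos two by (rule eventually_compose_filterlim)
  ultimately show ?thesis using hpos
  proof eventually_elim
    case (elim x)
    have g: "C / 2 * h x < g x" using elim by (simp add: field_simps)
    then have "g x > 0" using C elim by (smt (verit) divide_pos_pos mult_pos_pos)
    moreover have "h x \<le> 2 / C * g x" using g C by (simp add: field_simps)
    moreover have "g (2 * x) / g x < q" using elim by simp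
    ultimately show ?case by (simp add: field_simps)
  qed
qed

lemma asymp_equiv_imp_quotient_tendsto:
  fixes f g :: "real \<Rightarrow> real"
  assumes "f \<sim>[F] g" "\<forall>\<^sub>F x in F. f x > 0"
  shows "((\<lambda>x. g x / f x) \<longlongrightarrow> 1) F"
proof -
  \<comment> \<open>Asymptotic equivalence reads 0/0 as 1; eventual positivity of \<open>f\<close>
    rules this case out.\<close>
  have "((\<lambda>x. if g x = 0 \<and> f x = 0 then 1 else g x / f x) \<longlongrightarrow> 1) F"
    using asymp_equiv_symI[OF assms(1)] by (rule asymp_equivD)
  then show ?thesis
    by (rule Lim_transform_eventually) (use assms(2) in \<open>eventually_elim, auto\<close>)
qed

text \<open>Puts \<open>\<alpha> < 2\<close> and \<open>\<alpha> = 2\<close> into one form. The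
  function \<open>g\<close> stands in for \<open>h\<close> because it is built from a monotone
  function, which controls \<open>g (s * y)\<close> for all \<open>s\<close> in [1, 2] at once; slow
  variation of \<open>h\<close> gives a limit only for each fixed dilation.\<close>

lemma (in real_distribution) char_decay_stable_domain:
  fixes \<alpha> c1 c2 :: real and l h :: "real \<Rightarrow> real"
  assumes alpha: "0 < \<alpha>" "\<alpha> \<le> 2"
    and c12: "c1 + c2 > 0"
    and l_sv: "slowly_varying l"
    and right_tail: "(\<lambda>x. x powr \<alpha> * measure M {x<..} - c1 * l x) \<in> o[at_top](l)"
    and left_tail: "(\<lambda>x. x powr \<alpha> * measure M {..-x} - c2 * l x) \<in> o[at_top](l)"
    and mean0: "\<alpha> > 1 \<Longrightarrow> integrable M (\<lambda>x. x) \<and> (\<integral>x. x \<partial>M) = 0"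
    and h_sv: "slowly_varying h"
    and h_lt2: "\<alpha> < 2 \<Longrightarrow> h \<sim>[at_top] l"
    and h_eq2: "\<alpha> = 2 \<Longrightarrow> h \<sim>[at_top] (\<lambda>y. \<integral>x. x\<^sup>2 * indicator {-y..y} x \<partial>M)"
  obtains A c D K g where "A > 0" "c > 0" "D > 0" "K > 0"
    "\<And>y. y \<ge> K \<Longrightarrow> g y > 0" "\<And>y. y \<ge> K \<Longrightarrow> 0 < h y \<and> h y \<le> A * g y"
    "\<And>x y. K \<le> y \<Longrightarrow> y \<le> x \<Longrightarrow> g x \<le> D * (x / y) powr (\<alpha> / 2) * g y"
    "\<And>t. t \<noteq> 0 \<Longrightarrow> \<bar>t\<bar> \<le> 1 / K \<Longrightarrow> c * \<bar>t\<bar> powr \<alpha> * g (1 / \<bar>t\<bar>) \<le> 1 - cmod (char M t)"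
proof -
  have hpos: "\<forall>\<^sub>F x in at_top. h x > 0" using h_sv by (simp add: slowly_varying_def)
  have lpos: "\<forall>\<^sub>F x in at_top. l x > 0" using l_sv by (simp add: slowly_varying_def)
  have q: "2 powr (\<alpha> / 2) > 1" using alpha by simp
  have "\<exists>g C D. C > 0 \<and> D > 0 \<and> ((\<lambda>x. g x / h x) \<longlongrightarrow> C) at_top
     \<and> (\<exists>c>0. \<forall>\<^sub>F K in at_top. \<forall>t. t \<noteq> 0 \<longrightarrow> \<bar>t\<bar> \<le> 1 / K \<longrightarrow>
           c * \<bar>t\<bar> powr \<alpha> * g (1 / \<bar>t\<bar>) \<le> 1 - cmod (char M t))
     \<and> (\<forall>\<^sub>F K in at_top. \<forall>y s. y \<ge> K \<longrightarrow> 1 \<le> s \<longrightarrow> s \<le> 2 \<longrightarrow> g (s * y) \<le> D * g y)"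
  proof (cases "\<alpha> = 2")
    case False
    then have lt: "\<alpha> < 2" using alpha by simp
    define T where "T = (\<lambda>y. measure M {y<..} + measure M {..-y})"
    define g where "g = (\<lambda>y. y powr \<alpha> * T y)"
    have T_mono: "T z \<le> T y" if "y \<le> z" for y z
      unfolding T_def using that by (intro add_mono finite_measure_mono) auto
    have T0: "T y \<ge> 0" for y by (simp add: T_def)
    have "((\<lambda>x. (x powr \<alpha> * measure M {x<..} - c1 * l x) / l x + c1
        + ((x powr \<alpha> * measure M {..-x} - c2 * l x) / l x + c2)) \<longlongrightarrow> 0 + c1 + (0 + c2)) at_top"
      by (intro tendsto_intros smalloD_tendsto right_tail left_tail)
    then have "((\<lambda>x. g x / l x) \<longlongrightarrow> 0 + c1 + (0 + c2)) at_top"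
      by (rule Lim_transform_eventually)
         (use lpos in \<open>eventually_elim, simp add: g_def T_def field_simps\<close>)
    then have gl: "((\<lambda>x. g x / l x) \<longlongrightarrow> c1 + c2) at_top" by simp
    have lh: "((\<lambda>x. l x / h x) \<longlongrightarrow> 1) at_top"
      by (rule asymp_equiv_imp_quotient_tendsto[OF h_lt2[OF lt] hpos])
    have "((\<lambda>x. g x / l x * (l x / h x)) \<longlongrightarrow> (c1 + c2) * 1) at_top"
      by (intro tendsto_mult gl lh)
    then have "((\<lambda>x. g x / h x) \<longlongrightarrow> (c1 + c2) * 1) at_top"
      by (rule Lim_transform_eventually) (use lpos in \<open>eventually_elim, simp\<close>)
    then have gh: "((\<lambda>x. g x / h x) \<longlongrightarrow> c1 + c2) at_top" by simp
    have "\<forall>\<^sub>F y in at_top. g (2 * y) \<le> 2 powr (\<alpha> / 2) * g y"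
      using slowly_varying_equiv_doubling[OF h_sv gh c12 q] by eventually_elim simp
    then have decay: "\<exists>c>0. \<forall>\<^sub>F K in at_top. \<forall>t. t \<noteq> 0 \<longrightarrow> \<bar>t\<bar> \<le> 1 / K \<longrightarrow>
           c * \<bar>t\<bar> powr \<alpha> * g (1 / \<bar>t\<bar>) \<le> 1 - cmod (char M t)"
      using char_decay_regular_tail[OF alpha(1)] by (simp add: g_def T_def)
    \<comment> \<open>The tail \<open>T\<close> decreases, so only the factor
      \<open>s powr \<alpha>\<close> can make \<open>g\<close> grow.\<close>
    have "\<forall>\<^sub>F K in at_top. \<forall>y s. y \<ge> K \<longrightarrow> 1 \<le> s \<longrightarrow> s \<le> 2 \<longrightarrow> g (s * y) \<le> 2 powr \<alpha> * g y"
      using eventually_gt_at_top[of 0]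
    proof eventually_elim
      case (elim K)
      show ?case
      proof (intro allI impI)
        fix y s :: real assume y: "y \<ge> K" and s: "1 \<le> s" "s \<le> 2"
        have "g (s * y) = s powr \<alpha> * (y powr \<alpha> * T (s * y))"
          using y s elim by (simp add: g_def powr_mult)
        also have "\<dots> \<le> 2 powr \<alpha> * (y powr \<alpha> * T y)"
          using y s elim alpha T0
          by (intro mult_mono powr_mono2 T_mono) auto
        finally show "g (s * y) \<le> 2 powr \<alpha> * g y" by (simp add: g_def)
      qed
    qed
    then show ?thesis
      using decay gh c12 by (intro exI[of _ g] exI[of _ "c1 + c2"] exI[of _ "2 powr \<alpha>"]) auto
  next
    case True
    define V where "V = (\<lambda>y. \<integral>x. x\<^sup>2 * indicator {-y..y} x \<partial>M)"
    have int: "integrable M (\<lambda>x. x)" and mean: "(\<integral>x. x \<partial>M) = 0"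
      using mean0 True by auto
    have Vh: "((\<lambda>x. V x / h x) \<longlongrightarrow> 1) at_top"
      unfolding V_def by (rule asymp_equiv_imp_quotient_tendsto[OF h_eq2[OF True] hpos])
    have ev: "\<forall>\<^sub>F x in at_top. V x > 0 \<and> h x \<le> 2 / 1 * V x \<and> V (2 * x) \<le> 2 * V x"
      by (rule slowly_varying_equiv_doubling[OF h_sv Vh]) auto
    have V_mono: "V y \<le> V z" if "y \<le> z" for y z
      unfolding V_def using that by (rule truncated_square_mono)
    have "\<forall>\<^sub>F y in at_top. V y > 0" using ev by eventually_elim simp
    then have decay: "\<exists>c>0. \<forall>\<^sub>F K in at_top. \<forall>t. t \<noteq> 0 \<longrightarrow> \<bar>t\<bar> \<le> 1 / K \<longrightarrow>
           c * \<bar>t\<bar> powr \<alpha> * V (1 / \<bar>t\<bar>) \<le> 1 - cmod (char M t)"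
      using char_decay_truncated_variance[OF int mean] by (simp add: V_def True)
    have "\<forall>\<^sub>F y in at_top. V (2 * y) \<le> 2 * V y" using ev by eventually_elim simp
    then have "\<forall>\<^sub>F K in at_top. \<forall>y\<ge>K. V (2 * y) \<le> 2 * V y"
      by (rule eventually_all_ge_at_top)
    \<comment> \<open>Here \<open>V\<close> increases, so \<open>s * y\<close> may be replaced by
      \<open>2 * y\<close> and doubling applies.\<close>
    then have "\<forall>\<^sub>F K in at_top. \<forall>y s. y \<ge> K \<longrightarrow> 1 \<le> s \<longrightarrow> s \<le> 2 \<longrightarrow> V (s * y) \<le> 2 * V y"
      using eventually_gt_at_top[of 0]
    proof eventually_elim
      case (elim K)
      show ?case
      proof (intro allI impI)
        fix y s :: real assume "y \<ge> K" "1 \<le> s" "s \<le> 2"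
        then show "V (s * y) \<le> 2 * V y"
          using elim V_mono[of "s * y" "2 * y"] by (auto intro: order_trans)
      qed
    qed
    then show ?thesis
      using decay Vh by (intro exI[of _ V] exI[of _ 1] exI[of _ 2]) auto
  qed
  then obtain g C D c where C: "C > 0" and D: "D > 0" and gh: "((\<lambda>x. g x / h x) \<longlongrightarrow> C) at_top"
    and c: "c > 0" and decay: "\<forall>\<^sub>F K in at_top. \<forall>t. t \<noteq> 0 \<longrightarrow> \<bar>t\<bar> \<le> 1 / K \<longrightarrow>
           c * \<bar>t\<bar> powr \<alpha> * g (1 / \<bar>t\<bar>) \<le> 1 - cmod (char M t)"
    and loc: "\<forall>\<^sub>F K in at_top. \<forall>y s. y \<ge> K \<longrightarrow> 1 \<le> s \<longrightarrow> s \<le> 2 \<longrightarrow> g (s * y) \<le> D * g y"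
    by blast
  have "\<forall>\<^sub>F y in at_top. h y > 0 \<and> g y > 0 \<and> h y \<le> 2 / C * g y \<and> g (2 * y) \<le> 2 powr (\<alpha> / 2) * g y"
    using slowly_varying_equiv_doubling[OF h_sv gh C q] hpos by eventually_elim simp
  then have "\<forall>\<^sub>F x in at_top. \<forall>y\<ge>x. h y > 0 \<and> g y > 0 \<and> h y \<le> 2 / C * g y \<and> g (2 * y) \<le> 2 powr (\<alpha> / 2) * g y"
    by (rule eventually_all_ge_at_top)
  with decay loc have "\<forall>\<^sub>F K in at_top. K > 0 \<and> (\<forall>t. t \<noteq> 0 \<longrightarrow> \<bar>t\<bar> \<le> 1 / K \<longrightarrow>
           c * \<bar>t\<bar> powr \<alpha> * g (1 / \<bar>t\<bar>) \<le> 1 - cmod (char M t))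
    \<and> (\<forall>y s. y \<ge> K \<longrightarrow> 1 \<le> s \<longrightarrow> s \<le> 2 \<longrightarrow> g (s * y) \<le> D * g y)
    \<and> (\<forall>y\<ge>K. h y > 0 \<and> g y > 0 \<and> h y \<le> 2 / C * g y \<and> g (2 * y) \<le> 2 powr (\<alpha> / 2) * g y)"
    using eventually_gt_at_top[of 0] by eventually_elim blast
  then obtain K where K: "K > 0"
    and decayK: "\<And>t. t \<noteq> 0 \<Longrightarrow> \<bar>t\<bar> \<le> 1 / K \<Longrightarrow>
           c * \<bar>t\<bar> powr \<alpha> * g (1 / \<bar>t\<bar>) \<le> 1 - cmod (char M t)"
    and locK: "\<And>y s. y \<ge> K \<Longrightarrow> 1 \<le> s \<Longrightarrow> s \<le> 2 \<Longrightarrow> g (s * y) \<le> D * g y"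
    and gK: "\<And>y. y \<ge> K \<Longrightarrow> h y > 0 \<and> g y > 0 \<and> h y \<le> 2 / C * g y \<and> g (2 * y) \<le> 2 powr (\<alpha> / 2) * g y"
    by (auto dest!: eventually_happens)
  show ?thesis
  proof (rule that[of "2 / C" c D K g])
    show "g x \<le> D * (x / y) powr (\<alpha> / 2) * g y" if "K \<le> y" "y \<le> x" for x y
      using that K D alpha gK locK by (intro doubling_imp_potter_bound[where K=K]) auto
  qed (use C c D K gK decayK in auto)
qed

section \<open>Sums of independent lattice variables and the covariance bound\<close>

text \<open>The index set is left general so that both the partial sums and the increment over
  \<open>{m<..n}\<close> are covered.\<close>

lemma (in prob_space) prob_indep_sum_lattice_point_le:
  fixes X :: "nat \<Rightarrow> 'a \<Rightarrow> real"
  assumes indep: "indep_vars (\<lambda>_. borel) X I"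
    and ident: "\<And>i. i \<in> I \<Longrightarrow> distr M borel (X i) = \<mu>"
    and lat: "AE x in \<mu>. \<exists>k::int. x = a + of_int k"
    and I: "finite I"
    and x: "x = real (card I) * a + of_int k"
  shows "2 * pi * prob {\<omega>\<in>space M. (\<Sum>i\<in>I. X i \<omega>) = x}
       \<le> (\<integral>t. cmod (char \<mu> t) ^ card I \<partial>restrict_space lborel {-pi..pi})"
proof -
  have rv: "random_variable borel (X i)" if "i \<in> I" for i
    using indep that by (auto simp: indep_vars_def)
  have "AE \<omega> in M. \<forall>i\<in>I. \<exists>k::int. X i \<omega> = a + of_int k"
  proof (rule AE_finite_allI[OF I])
    fix i assume "i \<in> I"
    then show "AE \<omega> in M. \<exists>k::int. X i \<omega> = a + of_int k"
      using lat rv[of i] ident[of i] by (intro AE_distrD[of "X i" M borel]) auto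
  qed
  then have "AE \<omega> in M. \<exists>k::int. (\<Sum>i\<in>I. X i \<omega>) = x + of_int k"
  proof eventually_elim
    case (elim \<omega>)
    then obtain f :: "nat \<Rightarrow> int" where f: "\<forall>i\<in>I. X i \<omega> = a + of_int (f i)" by metis
    then have "(\<Sum>i\<in>I. X i \<omega>) = x + of_int ((\<Sum>i\<in>I. f i) - k)"
      by (simp add: x sum.distrib)
    then show ?case by blast
  qed
  moreover have "random_variable borel (\<lambda>\<omega>. \<Sum>i\<in>I. X i \<omega>)" using rv by measurable
  moreover have "cmod (char (distr M borel (\<lambda>\<omega>. \<Sum>i\<in>I. X i \<omega>)) t) = cmod (char \<mu> t) ^ card I" for t
    using ident by (simp add: char_distr_sum[OF indep] prod_norm[symmetric] norm_power)
  ultimately show ?thesis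
    using prob_lattice_point_le_char[of "\<lambda>\<omega>. \<Sum>i\<in>I. X i \<omega>" x] by simp
qed

lemma (in prob_space) prob_partial_sums_eq:
  fixes X :: "nat \<Rightarrow> 'a \<Rightarrow> real"
  assumes indep: "indep_vars (\<lambda>_. borel) X {1..}" and mn: "m \<le> n"
  shows "prob {\<omega>\<in>space M. partial_sum X m \<omega> = u \<and> partial_sum X n \<omega> = v}
       = prob {\<omega>\<in>space M. partial_sum X m \<omega> = u} * prob {\<omega>\<in>space M. (\<Sum>i\<in>{m<..n}. X i \<omega>) = v - u}"
proof -
  let ?S = "\<lambda>I \<omega>. \<Sum>i\<in>I. X i \<omega>"
  have "indep_var borel ((\<lambda>f. \<Sum>i\<in>{1..m}. f i) \<circ> (\<lambda>\<omega>. restrict (\<lambda>i. X i \<omega>) {1..m}))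
      borel ((\<lambda>f. \<Sum>i\<in>{m<..n}. f i) \<circ> (\<lambda>\<omega>. restrict (\<lambda>i. X i \<omega>) {m<..n}))"
    by (intro indep_var_compose[OF indep_var_restrict[OF indep]]) auto
  then have ind: "indep_var borel (?S {1..m}) borel (?S {m<..n})"
    by (simp add: comp_def)
  have split: "partial_sum X n \<omega> = ?S {1..m} \<omega> + ?S {m<..n} \<omega>" for \<omega>
  proof -
    have "{1..n} = {1..m} \<union> {m<..n}" using mn by auto
    then show ?thesis by (simp add: partial_sum_def) (subst sum.union_disjoint, auto)
  qed
  \<comment> \<open>In the independent coordinates given by the two blocks the event is a single
    point.\<close>
  have "{\<omega>\<in>space M. partial_sum X m \<omega> = u \<and> partial_sum X n \<omega> = v}
      = (\<lambda>\<omega>. (?S {1..m} \<omega>, ?S {m<..n} \<omega>)) -` ({u} \<times> {v - u}) \<inter> space M"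
    unfolding split by (auto simp: partial_sum_def)
  also have "prob \<dots> = prob (?S {1..m} -` {u} \<inter> space M) * prob (?S {m<..n} -` {v - u} \<inter> space M)"
    by (rule indep_varD[OF ind]) auto
  also have "?S {1..m} -` {u} \<inter> space M = {\<omega>\<in>space M. partial_sum X m \<omega> = u}"
    by (auto simp: partial_sum_def)
  also have "?S {m<..n} -` {v - u} \<inter> space M = {\<omega>\<in>space M. ?S {m<..n} \<omega> = v - u}"
    by auto
  finally show ?thesis .
qed

theorem theorem3p1:
  fixes M :: "'a measure" and X :: "nat \<Rightarrow> 'a \<Rightarrow> real"
    and a \<alpha> c1 c2 a0 \<kappa>0 :: real and l h :: "real \<Rightarrow> real"
    and L b \<kappa> :: "nat \<Rightarrow> real"
  assumes prob: "prob_space M"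
    and meas: "\<And>i. X i \<in> borel_measurable M"
    and indep: "prob_space.indep_vars M (\<lambda>_. borel) X {1..}"
    and ident: "\<And>i. i \<ge> 1 \<Longrightarrow> distr M borel (X i) = distr M borel (X 1)"
    and lattice: "lattice_maximal_span_one M (X 1) a"
    and alpha: "0 < \<alpha>" "\<alpha> \<le> 2" "\<alpha> \<noteq> 1"
    and c12: "c1 \<ge> 0" "c2 \<ge> 0" "c1 + c2 > 0"
    and l_sv: "slowly_varying l"
    and right_tail: "(\<lambda>x. x powr \<alpha> * measure M {\<omega> \<in> space M. X 1 \<omega> > x} - c1 * l x)
                       \<in> o[at_top](l)"
    and left_tail: "(\<lambda>x. x powr \<alpha> * measure M {\<omega> \<in> space M. X 1 \<omega> \<le> - x} - c2 * l x)
                       \<in> o[at_top](l)"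
    and mean0: "\<alpha> > 1 \<Longrightarrow> integrable M (X 1) \<and> integral\<^sup>L M (X 1) = 0"
    and h_sv: "slowly_varying h"
    and h_cont: "a0 > 0" "continuous_on {a0..} h" "\<And>x. x \<ge> a0 \<Longrightarrow> h x > 0"
    and h_lt2: "\<alpha> < 2 \<Longrightarrow> h \<sim>[at_top] l"
    and h_eq2: "\<alpha> = 2 \<Longrightarrow>
                  h \<sim>[at_top] (\<lambda>x. integral\<^sup>L M (\<lambda>\<omega>. if \<bar>X 1 \<omega>\<bar> \<le> x then (X 1 \<omega>)\<^sup>2 else 0))"
    and L_pos: "\<And>n. n \<ge> 1 \<Longrightarrow> L n > 0"
    and b_def: "\<And>n. n \<ge> 1 \<Longrightarrow> b n = L n * real n powr (1 / \<alpha>)"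
    and L_h: "\<forall>\<^sub>F n in sequentially. L n = h (b n) powr (1 / \<alpha>)"
    and kappa_lattice: "\<And>n. \<exists>k::int. \<kappa> n = real n * a + of_int k"
    and kappa_lim: "(\<lambda>n. \<kappa> n / b n) \<longlonglongrightarrow> \<kappa>0"
  shows "\<exists>C::real. \<forall>m n. 1 \<le> m \<and> m < n \<longrightarrow>
           b m * b n * \<bar>measure M {\<omega> \<in> space M. partial_sum X m \<omega> = \<kappa> m \<and> partial_sum X n \<omega> = \<kappa> n}
              - measure M {\<omega> \<in> space M. partial_sum X m \<omega> = \<kappa> m}
                * measure M {\<omega> \<in> space M. partial_sum X n \<omega> = \<kappa> n}\<bar>
           \<le> C * ((real n / real (n - m)) powr (1 / \<alpha>) * L n / L (n - m) + 1)"
proof -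
  interpret prob_space M by fact
  define \<mu> where "\<mu> = distr M borel (X 1)"
  interpret D: real_distribution \<mu>
    unfolding \<mu>_def by (rule real_distribution_distr[OF meas])
  note [measurable] = meas
  have lat1: "AE \<omega> in M. \<exists>k::int. X 1 \<omega> = a + of_int k"
    and span: "\<And>a' d. d > 1 \<Longrightarrow> \<not> (AE \<omega> in M. \<exists>k::int. X 1 \<omega> = a' + d * of_int k)"
    using lattice by (auto simp: lattice_maximal_span_one_def supported_on_lattice_def)
  have lat: "AE x in \<mu>. \<exists>k::int. x = a + of_int k"
    unfolding \<mu>_def using lat1 by (subst AE_distr_iff) auto
  \<comment> \<open>Modulus 1 at such a \<open>t\<close> would give a lattice of span
    \<open>2 * pi / \<bar>t\<bar>\<close>, which is at least 2 and contradicts maximality of the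
    span 1.\<close>
  have lt1: "cmod (char \<mu> t) < 1" if t: "t \<noteq> 0" "\<bar>t\<bar> \<le> pi" for t
  proof (rule ccontr)
    assume "\<not> cmod (char \<mu> t) < 1"
    then have "cmod (char \<mu> t) = 1" using D.cmod_char_le_1[of t] by simp
    then obtain a' where "AE x in \<mu>. \<exists>k::int. x = a' + 2 * pi / \<bar>t\<bar> * of_int k"
      using D.cmod_char_eq_1_imp_lattice[OF _ t(1)] by auto
    then have "AE \<omega> in M. \<exists>k::int. X 1 \<omega> = a' + 2 * pi / \<bar>t\<bar> * of_int k"
      unfolding \<mu>_def by (intro AE_distrD[of "X 1" M borel]) auto
    moreover have "2 * pi / \<bar>t\<bar> > 1" using t pi_gt_zero by (simp add: field_simps)
    ultimately show False using span by blast
  qed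
  have tail_eq: "measure \<mu> {x<..} = measure M {\<omega> \<in> space M. X 1 \<omega> > x}"
    "measure \<mu> {..- x} = measure M {\<omega> \<in> space M. X 1 \<omega> \<le> - x}" for x
    unfolding \<mu>_def by (subst measure_distr; auto intro!: arg_cong[where f=prob])+
  have V_eq: "(\<integral>x. x\<^sup>2 * indicator {-y..y} x \<partial>\<mu>) = (\<integral>\<omega>. (if \<bar>X 1 \<omega>\<bar> \<le> y then (X 1 \<omega>)\<^sup>2 else 0) \<partial>M)" for y
    unfolding \<mu>_def by (subst integral_distr) (auto intro!: Bochner_Integration.integral_cong simp: indicator_def)
  have mean: "\<alpha> > 1 \<Longrightarrow> integrable \<mu> (\<lambda>x. x) \<and> (\<integral>x. x \<partial>\<mu>) = 0"
    using mean0 unfolding \<mu>_def by (auto simp: integrable_distr_eq integral_distr)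
  obtain A c D K g where A: "A > 0" and c: "c > 0" and D: "D > 0" and K: "K > 0"
    and gpos: "\<And>y. y \<ge> K \<Longrightarrow> g y > 0" and hg: "\<And>y. y \<ge> K \<Longrightarrow> 0 < h y \<and> h y \<le> A * g y"
    and potter: "\<And>x y. K \<le> y \<Longrightarrow> y \<le> x \<Longrightarrow> g x \<le> D * (x / y) powr (\<alpha> / 2) * g y"
    and decay: "\<And>t. t \<noteq> 0 \<Longrightarrow> \<bar>t\<bar> \<le> 1 / K \<Longrightarrow> c * \<bar>t\<bar> powr \<alpha> * g (1 / \<bar>t\<bar>) \<le> 1 - cmod (char \<mu> t)"
  proof (rule D.char_decay_stable_domain[OF alpha(1,2) c12(3) l_sv _ _ mean h_sv h_lt2 h_eq2[folded V_eq],
          unfolded tail_eq, OF right_tail left_tail], goal_cases)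
    case (4 A c D K g)
    show ?thesis by (rule 4(1)[OF 4(2-9)])
  qed assumption+
  have cont: "continuous_on UNIV (\<lambda>t. cmod (char \<mu> t))"
    by (intro continuous_on_norm continuous_at_imp_continuous_on ballI D.isCont_char)
  have "\<exists>C\<ge>0. \<forall>B\<ge>K. \<forall>n\<ge>1. \<forall>t. B powr \<alpha> \<le> A * real n * g B \<longrightarrow> \<bar>t\<bar> \<le> pi
      \<longrightarrow> cmod (char \<mu> t) ^ n \<le> C / (1 + B\<^sup>2 * t\<^sup>2)"
    by (rule power_le_cauchy_kernel[OF cont norm_ge_zero D.cmod_char_le_1 lt1 alpha(1) K c D A
          gpos potter decay]) assumption+
  then obtain C where C: "C \<ge> 0"
    and kernel: "\<And>B n t. B \<ge> K \<Longrightarrow> n \<ge> 1 \<Longrightarrow> B powr \<alpha> \<le> A * real n * g B \<Longrightarrow> \<bar>t\<bar> \<le> pi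
      \<Longrightarrow> cmod (char \<mu> t) ^ n \<le> C / (1 + B\<^sup>2 * t\<^sup>2)"
    by blast
  obtain N where N: "\<And>n. n \<ge> N \<Longrightarrow> L n = h (b n) powr (1 / \<alpha>)"
    using L_h unfolding eventually_sequentially by auto
  \<comment> \<open>\<open>C / 2\<close> is the kernel integral \<open>C * pi / b n\<close> after
    division by \<open>2 * pi\<close>; \<open>K\<close> covers the \<open>n\<close> with
    \<open>b n\<close> below the threshold; the sum covers \<open>n < N\<close>, before the relation
    between \<open>L\<close> and \<open>h\<close> sets in.\<close>
  define E where "E = C / 2 + K + (\<Sum>i<N. \<bar>b i\<bar>)"
  have bpos: "b n > 0" if "n \<ge> 1" for n
    using that L_pos[of n] b_def[of n] by simp
  have E: "E \<ge> 0" using C K by (auto simp: E_def intro!: add_nonneg_nonneg sum_nonneg)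
  have conc: "b (card I) * prob {\<omega>\<in>space M. (\<Sum>i\<in>I. X i \<omega>) = x} \<le> E"
    if I: "finite I" "I \<subseteq> {1..}" "card I \<ge> 1" and x: "x = real (card I) * a + of_int k" for I x k
  proof -
    let ?n = "card I" and ?P = "prob {\<omega>\<in>space M. (\<Sum>i\<in>I. X i \<omega>) = x}"
    have b0: "b ?n > 0" using bpos I by simp
    have bP: "b ?n * ?P \<le> b ?n * 1" using b0 by (intro mult_left_mono) auto
    have S0: "0 \<le> (\<Sum>i<N. \<bar>b i\<bar>)" by (simp add: sum_nonneg)
    consider "?n < N" | "b ?n \<le> K" | "?n \<ge> N" "b ?n \<ge> K" by linarith
    then show ?thesis
    proof cases
      case 1
      then have "\<bar>b ?n\<bar> \<le> (\<Sum>i<N. \<bar>b i\<bar>)" by (intro member_le_sum) auto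
      then show ?thesis using bP C K unfolding E_def by linarith
    next
      case 2
      then show ?thesis using bP C S0 unfolding E_def by linarith
    next
      case 3
      have h0: "h (b ?n) > 0" using hg 3 by blast
      \<comment> \<open>The normalization satisfies \<open>b n powr \<alpha> = n * h (b n)\<close>,
        which is the growth condition of the kernel bound with \<open>B = b n\<close> once
        \<open>h\<close> is replaced by \<open>A * g\<close>.\<close>
      have "b ?n powr \<alpha> = (L ?n) powr \<alpha> * (real ?n powr (1 / \<alpha>)) powr \<alpha>"
        using b_def[of ?n] I L_pos[of ?n] by (simp add: powr_mult)
      also have "\<dots> = h (b ?n) * real ?n"
        using N[OF 3(1)] h0 alpha(1) I by (simp add: powr_powr)
      also have "\<dots> \<le> A * g (b ?n) * real ?n"
        using hg[OF 3(2)] by (intro mult_right_mono) auto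
      finally have B: "b ?n powr \<alpha> \<le> A * real ?n * g (b ?n)" by (simp add: mult_ac)
      have ind: "indep_vars (\<lambda>_. borel) X I"
        by (rule indep_vars_subset[OF indep I(2)])
      have "2 * pi * ?P \<le> (\<integral>t. cmod (char \<mu> t) ^ ?n \<partial>restrict_space lborel {-pi..pi})"
      proof (rule prob_indep_sum_lattice_point_le[OF ind _ lat I(1) x])
        show "distr M borel (X i) = \<mu>" if "i \<in> I" for i
          unfolding \<mu>_def by (rule ident) (use that I(2) in auto)
      qed
      also have "\<dots> \<le> C * pi / b ?n"
        by (rule integral_le_arctan_kernel) (use b0 C kernel[OF 3(2) I(3) B] in auto)
      finally have "b ?n * ?P \<le> C / 2" using b0 by (simp add: field_simps)
      then show ?thesis using K S0 unfolding E_def by linarith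
    qed
  qed
  have main: "b m * b n * \<bar>measure M {\<omega> \<in> space M. partial_sum X m \<omega> = \<kappa> m \<and> partial_sum X n \<omega> = \<kappa> n}
              - measure M {\<omega> \<in> space M. partial_sum X m \<omega> = \<kappa> m}
                * measure M {\<omega> \<in> space M. partial_sum X n \<omega> = \<kappa> n}\<bar>
           \<le> E\<^sup>2 * ((real n / real (n - m)) powr (1 / \<alpha>) * L n / L (n - m) + 1)"
    if mn: "1 \<le> m" "m < n" for m n
  proof -
    define p where "p = (\<lambda>n. prob {\<omega>\<in>space M. partial_sum X n \<omega> = \<kappa> n})"
    define p' where "p' = prob {\<omega>\<in>space M. (\<Sum>i\<in>{m<..n}. X i \<omega>) = \<kappa> n - \<kappa> m}"
    have p_le: "b j * p j \<le> E" if "j \<ge> 1" for j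
    proof -
      obtain k :: int where "\<kappa> j = real j * a + of_int k" using kappa_lattice by blast
      then show ?thesis using conc[of "{1..j}" "\<kappa> j" k] that by (auto simp: p_def partial_sum_def)
    qed
    have p'_le: "b (n - m) * p' \<le> E"
    proof -
      obtain k k' :: int where "\<kappa> n = real n * a + of_int k" "\<kappa> m = real m * a + of_int k'"
        using kappa_lattice by blast
      then have x: "\<kappa> n - \<kappa> m = real (card {m<..n}) * a + of_int (k - k')"
        using mn by (simp add: of_nat_diff algebra_simps)
      have "b (card {m<..n}) * p' \<le> E"
        unfolding p'_def by (rule conc[OF _ _ _ x]) (use mn in auto)
      then show ?thesis by simp
    qed
    have b0: "b m > 0" "b n > 0" "b (n - m) > 0" using bpos mn by auto
    have p0: "p m \<ge> 0" "p n \<ge> 0" "p' \<ge> 0" by (auto simp: p_def p'_def)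
    have ratio: "b n / b (n - m) = (real n / real (n - m)) powr (1 / \<alpha>) * L n / L (n - m)"
      using mn b_def[of n] b_def[of "n - m"] by (simp add: powr_divide mult.commute)
    \<comment> \<open>Independence has made \<open>p m\<close> a common factor, and the difference
      \<open>p' - p n\<close> is bounded without any cancellation: \<open>p'\<close> is of order
      \<open>1 / b (n - m)\<close> and yields the ratio, \<open>p n\<close> is of order
      \<open>1 / b n\<close> and yields the summand 1.\<close>
    have "b m * b n * \<bar>p m * p' - p m * p n\<bar> = (b m * p m) * (b n * \<bar>p' - p n\<bar>)"
      using p0 by (simp add: right_diff_distrib[symmetric] abs_mult)
    also have "\<dots> \<le> E * (b n * (p' + p n))"
      using p_le[OF mn(1)] b0 p0 E by (intro mult_mono mult_left_mono) auto
    also have "b n * (p' + p n) = b n / b (n - m) * (b (n - m) * p') + b n * p n"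
      using b0 by (simp add: field_simps)
    also have "E * \<dots> \<le> E * (b n / b (n - m) * E + E)"
      using p'_le p_le[of n] mn b0 E by (intro mult_left_mono add_mono) auto
    also have "\<dots> = E\<^sup>2 * (b n / b (n - m) + 1)"
      by (simp add: power2_eq_square algebra_simps)
    finally show ?thesis
      using prob_partial_sums_eq[OF indep, of m n] mn unfolding ratio p_def p'_def by simp
  qed
  then show ?thesis by blast
qed

end
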